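(* Let $n=p+q$ be a natural number, let $h^1,\dots,h^n:\mathbb{R}^{p,q}\to\mathcal{C}\ell(p,q)$ be a smooth Clifford field vector, $h_\rho=\eta_{\rho\mu}h^\mu$, and let $C_1,\dots,C_n:\mathbb{R}^{p,q}\to\mathcal{C}\ell_{\circledS}(p,q)$ be smooth. Put $n'=n$ if $n$ is even and $n'=n-1$ if $n$ is odd, and $\mu_k=\dfrac{1}{n-(-1)^k(n-2k)}$ for $1\le k\le n'$. Then the following are equivalent: (a) $\partial_\mu h_\rho-[C_\mu,h_\rho]=0$ for all $\mu,\rho=1,\dots,n$; (b) $C_\mu=\sum_{k=1}^{n'}\mu_k\,\pi[h]_k\big((\partial_\mu h^\rho)h_\rho\big)$ for all $\mu=1,\dots,n$ (summation over $\rho$).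
   Context: $\mathbb{R}^{p,q}$ is $\mathbb{R}^n$ with Cartesian coordinates $x^\mu$, $\partial_\mu=\partial/\partial x^\mu$, metric $\eta=(\eta_{\mu\nu})=(\eta^{\mu\nu})=\mathrm{diag}(1,\dots,1,-1,\dots,-1)$ ($p$ ones, $q$ minus ones); Einstein summation is used. $\mathcal{C}\ell(p,q)$ is the complex Clifford algebra with identity $e$ and generators $e^1,\dots,e^n$, $e^ae^b+e^be^a=2\eta^{ab}e$, with basis $e$, $e^{a_1\dots a_k}=e^{a_1}\cdots e^{a_k}$ ($a_1<\dots<a_k$); functions into it are differentiated coefficientwise. $[U,V]=UV-VU$. $\mathrm{Tr}(U)$ is the coefficient of $e$ in $U$. The center is spanned by $e$ for even $n$ and by $e$ and $e^{1\dots n}$ for odd $n$; $\mathcal{C}\ell_{\circledS}(p,q)$ is the set of elements with zero projection onto the center (w.r.t. the basis above). A Clifford field vector is a collection $h^\mu:\mathbb{R}^{p,q}\to\mathcal{C}\ell(p,q)$, $\mu=1,\dots,n$, with $h^\mu h^\nu+h^\nu h^\mu=2\eta^{\mu\nu}e$ and $\mathrm{Tr}(h^1\cdots h^n)=0$ at every point. At each point the elements $e$ and $h^{\nu_1}\cdots h^{\nu_k}$ ($1\le\nu_1<\dots<\nu_k\le n$, $k=1,\dots,n$) form a basis of $\mathcal{C}\ell(p,q)$ (the algebra of $h$-forms); for $k=0,\dots,n$, $\pi[h]_k$ denotes the projection onto the span of the products with exactly $k$ factors (the span of $e$ for $k=0$) with respect to this basis. *)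

theory Defs
  imports "HOL-Analysis.Analysis"
begin

text \<open>Elements of the complex Clifford algebra Cl(p,q), n = p+q, are represented by their
  coefficient functions w.r.t. the basis e_A, A a subset of {1..n} (A = {} gives the identity e).
  Coefficients on sets not contained in {1..n} are required to vanish (predicate cl_elem).\<close>

type_synonym cl = "nat set \<Rightarrow> complex"

definition eta :: "nat \<Rightarrow> nat \<Rightarrow> complex" where
  "eta p i = (if i \<le> p then 1 else -1)"

definition cl_elem :: "nat \<Rightarrow> cl \<Rightarrow> bool" where
  "cl_elem n U \<longleftrightarrow> (\<forall>A. \<not> A \<subseteq> {1..n} \<longrightarrow> U A = 0)"

definition cl_one :: cl where
  "cl_one = (\<lambda>A. if A = {} then 1 else 0)"

text \<open>e_A e_B = cl_sign p A B * e_(A symmetric difference B)\<close>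
definition cl_sign :: "nat \<Rightarrow> nat set \<Rightarrow> nat set \<Rightarrow> complex" where
  "cl_sign p A B = (-1) ^ card {(a, b). a \<in> A \<and> b \<in> B \<and> b < a} * (\<Prod>c\<in>A \<inter> B. eta p c)"

definition cl_mult :: "nat \<Rightarrow> nat \<Rightarrow> cl \<Rightarrow> cl \<Rightarrow> cl" where
  "cl_mult n p U V = (\<lambda>D. \<Sum>A\<in>Pow {1..n}. \<Sum>B\<in>Pow {1..n}.
      if (A - B) \<union> (B - A) = D then cl_sign p A B * U A * V B else 0)"

definition cl_comm :: "nat \<Rightarrow> nat \<Rightarrow> cl \<Rightarrow> cl \<Rightarrow> cl" where
  "cl_comm n p U V = (\<lambda>D. cl_mult n p U V D - cl_mult n p V U D)"

definition cl_prodlist :: "nat \<Rightarrow> nat \<Rightarrow> cl list \<Rightarrow> cl" where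
  "cl_prodlist n p xs = foldr (cl_mult n p) xs cl_one"

definition cl_tr :: "cl \<Rightarrow> complex" where
  "cl_tr U = U {}"

text \<open>Zero projection onto the center: span of e (n even), span of e and e^{1..n} (n odd).\<close>
definition cl_centerless :: "nat \<Rightarrow> cl \<Rightarrow> bool" where
  "cl_centerless n U \<longleftrightarrow> U {} = 0 \<and> (odd n \<longrightarrow> U {1..n} = 0)"

definition clifford_field_vector :: "nat \<Rightarrow> nat \<Rightarrow> (nat \<Rightarrow> 'a \<Rightarrow> cl) \<Rightarrow> bool" where
  "clifford_field_vector n p h \<longleftrightarrow> (\<forall>x.
     (\<forall>\<mu>\<in>{1..n}. cl_elem n (h \<mu> x)) \<and>
     (\<forall>\<mu>\<in>{1..n}. \<forall>\<nu>\<in>{1..n}.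
        (\<lambda>A. cl_mult n p (h \<mu> x) (h \<nu> x) A + cl_mult n p (h \<nu> x) (h \<mu> x) A)
        = (\<lambda>A. 2 * (if \<mu> = \<nu> then eta p \<mu> else 0) * cl_one A)) \<and>
     cl_tr (cl_prodlist n p (map (\<lambda>\<mu>. h \<mu> x) [1..<n+1])) = 0)"

text \<open>h_rho = eta_{rho mu} h^mu (eta diagonal)\<close>
definition hlow :: "nat \<Rightarrow> (nat \<Rightarrow> 'a \<Rightarrow> cl) \<Rightarrow> nat \<Rightarrow> 'a \<Rightarrow> cl" where
  "hlow p h \<rho> x = (\<lambda>A. eta p \<rho> * h \<rho> x A)"

definition hprod :: "nat \<Rightarrow> nat \<Rightarrow> (nat \<Rightarrow> cl) \<Rightarrow> nat set \<Rightarrow> cl" where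
  "hprod n p H S = cl_prodlist n p (map H (sorted_list_of_set S))"

definition hcoeffs :: "nat \<Rightarrow> nat \<Rightarrow> (nat \<Rightarrow> cl) \<Rightarrow> cl \<Rightarrow> (nat set \<Rightarrow> complex)" where
  "hcoeffs n p H U = (THE c. (\<forall>S. \<not> S \<subseteq> {1..n} \<longrightarrow> c S = 0) \<and>
       U = (\<lambda>A. \<Sum>S\<in>Pow {1..n}. c S * hprod n p H S A))"

definition hproj :: "nat \<Rightarrow> nat \<Rightarrow> (nat \<Rightarrow> cl) \<Rightarrow> nat \<Rightarrow> cl \<Rightarrow> cl" where
  "hproj n p H k U = (\<lambda>A. \<Sum>S\<in>{S\<in>Pow {1..n}. card S = k}. hcoeffs n p H U S * hprod n p H S A)"

coinductive smooth_fun :: "('a::euclidean_space \<Rightarrow> complex) \<Rightarrow> bool" where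
  "(\<forall>x. f differentiable (at x)) \<Longrightarrow>
   (\<forall>v\<in>Basis. smooth_fun (\<lambda>x. frechet_derivative f (at x) v)) \<Longrightarrow> smooth_fun f"

definition smooth_cl :: "('a::euclidean_space \<Rightarrow> cl) \<Rightarrow> bool" where
  "smooth_cl F \<longleftrightarrow> (\<forall>A. smooth_fun (\<lambda>x. F x A))"

text \<open>Partial derivative d_mu (coefficientwise), b mu the mu-th Cartesian basis vector.\<close>
definition pd :: "(nat \<Rightarrow> 'a::euclidean_space) \<Rightarrow> ('a \<Rightarrow> cl) \<Rightarrow> nat \<Rightarrow> 'a \<Rightarrow> cl" where
  "pd b F \<mu> x = (\<lambda>A. vector_derivative (\<lambda>t::real. F (x + t *\<^sub>R b \<mu>) A) (at 0))"

definition nprime :: "nat \<Rightarrow> nat" where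
  "nprime n = (if even n then n else n - 1)"

definition mu_coef :: "nat \<Rightarrow> nat \<Rightarrow> complex" where
  "mu_coef n k = 1 / of_int (int n - (-1) ^ k * (int n - 2 * int k))"

end

theory Submission
  imports Defs "HOL-Library.Function_Algebras"
begin

text \<open>
  At a point, the products \<open>h\<^sub>S\<close> multiply by the same sign cocycle as the standard basis, so
  \<open>e\<^sub>S \<mapsto> h\<^sub>S\<close> extends to an algebra endomorphism. It preserves the trace, whose bilinear form is
  nondegenerate, so it is injective and, by dimension, an automorphism; the \<open>h\<close>-coefficients are
  its inverse. In the standard basis \<open>\<Sum>\<^sub>r [c, e\<^sup>r] e\<^sub>r\<close> is diagonal with eigenvalue
  \<open>n - (-1)\<^sup>k (n - 2k)\<close> in rank \<open>k\<close>, which vanishes exactly on the center; hence (a) determines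
  \<open>C\<close> and gives (b). For the converse it suffices that some \<open>C'\<close> satisfies (a), since its
  noncentral part must then be given by the formula in (b); averaging \<open>(\<partial> h\<^sub>S) h\<^sub>S\<^sup>-\<^sup>1\<close> over all
  \<open>S\<close> produces such a \<open>C'\<close>.
\<close>

declare One_nat_def [simp del]

section \<open>Products of signs over symmetric differences\<close>

text \<open>The factors on \<open>A \<inter> B\<close> occur twice on the right and cancel because
  every value squares to 1.\<close>

lemma prod_sym_diff:
  fixes f :: "'b \<Rightarrow> 'c::comm_monoid_mult"
  assumes "finite A" "finite B" and sq: "\<And>x. f x * f x = 1"
  shows "prod f (sym_diff A B) = prod f A * prod f B"
proof -
  have A: "prod f A = prod f (A - B) * prod f (A \<inter> B)"
    using assms by (metis prod.Int_Diff mult.commute)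
  have B: "prod f B = prod f (B - A) * prod f (A \<inter> B)"
    using assms by (metis prod.Int_Diff inf_commute mult.commute)
  have "prod f (A \<inter> B) * prod f (A \<inter> B) = 1"
    by (simp add: prod.distrib[symmetric] sq)
  then have "prod f A * prod f B = prod f (A - B) * prod f (B - A)"
    unfolding A B by (metis (no_types, lifting) mult.assoc mult.commute mult_1)
  also have "\<dots> = prod f (sym_diff A B)"
    using assms by (subst prod.union_disjoint) auto
  finally show ?thesis by simp
qed

lemma sym_diff_eq_iff: "sym_diff A B = D \<longleftrightarrow> B = sym_diff A D"
  by blast

lemma sym_diff_assoc: "sym_diff (sym_diff A B) C = sym_diff A (sym_diff B C)"
  by blast

section \<open>The sign cocycle\<close>

text \<open>Contribution of one pair of indices to the sign of \<open>e_A e_B\<close>: an inversion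
  costs a transposition, a coincidence leaves the square of the generator.\<close>

definition gen_sign :: "nat \<Rightarrow> nat \<Rightarrow> nat \<Rightarrow> complex" where
  "gen_sign p a b = (if b < a then - 1 else if a = b then eta p a else 1)"

lemma eta_sq [simp]: "eta p a * eta p a = 1" "eta p a * (eta p a * z) = z"
  by (auto simp: eta_def)

lemma gen_sign_sq: "gen_sign p a b * gen_sign p a b = 1"
  by (auto simp: gen_sign_def)

text \<open>The exponent in \<open>cl_sign\<close> counts inversions, so both of its factors are
  products over pairs. In this form the sign is visibly multiplicative in each argument.\<close>

lemma cl_sign_eq_prod:
  assumes "finite A" "finite B"
  shows "cl_sign p A B = (\<Prod>a\<in>A. \<Prod>b\<in>B. gen_sign p a b)"
proof -
  have "(\<Prod>a\<in>A. \<Prod>b\<in>B. gen_sign p a b) =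
      (\<Prod>(a,b)\<in>A\<times>B. (if b < a then - 1 else 1) * (if a = b then eta p a else 1))"
    unfolding prod.cartesian_product by (intro prod.cong) (auto simp: gen_sign_def)
  also have "\<dots> = (\<Prod>z\<in>A\<times>B. if snd z < fst z then - 1 else 1) *
      (\<Prod>z\<in>A\<times>B. if fst z = snd z then eta p (fst z) else 1)"
    by (simp add: prod.distrib case_prod_unfold)
  also have "(\<Prod>z\<in>A\<times>B. if snd z < fst z then - 1 else (1::complex)) =
      (-1) ^ card {(a, b). a \<in> A \<and> b \<in> B \<and> b < a}"
  proof -
    have "{z \<in> A \<times> B. snd z < fst z} = {(a, b). a \<in> A \<and> b \<in> B \<and> b < a}" by auto
    then show ?thesis
      using assms by (simp add: prod.If_cases Int_def)
  qed
  also have "(\<Prod>z\<in>A\<times>B. if fst z = snd z then eta p (fst z) else 1) = (\<Prod>c\<in>A \<inter> B. eta p c)"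
  proof -
    have "(\<Prod>z\<in>A\<times>B. if fst z = snd z then eta p (fst z) else 1) =
        (\<Prod>z\<in>{z\<in>A\<times>B. fst z = snd z}. eta p (fst z))"
      using assms by (simp add: prod.If_cases Int_def)
    also have "\<dots> = (\<Prod>c\<in>A \<inter> B. eta p c)"
      by (rule prod.reindex_bij_witness[of _ "\<lambda>c. (c, c)" fst]) auto
    finally show ?thesis .
  qed
  finally show ?thesis by (simp add: cl_sign_def)
qed

text \<open>Pair signs square to 1, so \<open>prod_sym_diff\<close> applies. Multiplicativity in
  each slot is what later yields associativity.\<close>

lemma cl_sign_sym_diff_left:
  assumes "finite A" "finite B" "finite C"
  shows "cl_sign p (sym_diff A B) C = cl_sign p A C * cl_sign p B C"
  using assms
  by (simp add: cl_sign_eq_prod prod_sym_diff prod.distrib[symmetric] gen_sign_sq)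

lemma cl_sign_sym_diff_right:
  assumes "finite A" "finite B" "finite C"
  shows "cl_sign p A (sym_diff B C) = cl_sign p A B * cl_sign p A C"
  using assms
  by (simp add: cl_sign_eq_prod prod_sym_diff prod.distrib[symmetric] gen_sign_sq)

lemma cl_sign_sq:
  assumes "finite A" "finite B"
  shows "cl_sign p A B * cl_sign p A B = 1" "cl_sign p A B * (cl_sign p A B * z) = z"
proof -
  show *: "cl_sign p A B * cl_sign p A B = 1"
    using assms by (simp add: cl_sign_eq_prod prod.distrib[symmetric] gen_sign_sq)
  show "cl_sign p A B * (cl_sign p A B * z) = z"
    by (simp add: * mult.assoc[symmetric])
qed

lemma cl_sign_nonzero: "finite A \<Longrightarrow> finite B \<Longrightarrow> cl_sign p A B \<noteq> 0"
  using cl_sign_sq(1)[of A B p] by auto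

lemma cl_sign_empty [simp]: "cl_sign p {} A = 1" "cl_sign p A {} = 1"
  by (auto simp: cl_sign_def)

text \<open>This product is the sign by which \<open>e_r\<close> and \<open>e_S\<close> commute. For
  \<open>b \<noteq> r\<close> exactly one of the pairs (r, b), (b, r) is an inversion; for
  \<open>b = r\<close> the two factors \<open>eta\<close> cancel. The exponent has the parity of
  \<open>card (S - {r})\<close>.\<close>

lemma cl_sign_commute_single:
  assumes "finite S"
  shows "cl_sign p {r} S * cl_sign p S {r} = (-1) ^ (card S + (if r \<in> S then 1 else 0))"
proof -
  have "cl_sign p {r} S * cl_sign p S {r} = (\<Prod>b\<in>S. if b = r then 1 else - 1)"
    using assms
    by (simp add: cl_sign_eq_prod prod.distrib[symmetric])
       (intro prod.cong, auto simp: gen_sign_def)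
  also have "\<dots> = (-1) ^ card (S - {r})"
    using assms by (simp add: prod.If_cases Int_def Diff_eq Compl_eq)
  also have "\<dots> = (-1) ^ (card S + (if r \<in> S then 1 else 0))"
  proof (cases "r \<in> S")
    case True
    then obtain T where "S = insert r T" "r \<notin> T" by (metis mk_disjoint_insert)
    then show ?thesis using assms by (simp add: One_nat_def)
  qed simp
  finally show ?thesis .
qed

section \<open>Algebra structure\<close>

definition cl_scale :: "complex \<Rightarrow> cl \<Rightarrow> cl" where
  "cl_scale z U = (\<lambda>A. z * U A)"

definition cl_basis :: "nat set \<Rightarrow> cl" where
  "cl_basis S = (\<lambda>A. if A = S then 1 else 0)"

lemma cl_scale_apply [simp]: "cl_scale z U A = z * U A"
  by (simp add: cl_scale_def)

lemma cl_sum_apply: "(\<Sum>i\<in>I. F i) A = (\<Sum>i\<in>I. (F i :: cl) A)"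
  by (induction I rule: infinite_finite_induct) auto

text \<open>Gives access to span and independence, on which the dimension count in
  \<open>hcomb_surj\<close> rests. The ambient space consists of all coefficient functions;
  \<open>cl_elem\<close> cuts out the algebra.\<close>

interpretation cl: vector_space cl_scale
  by unfold_locales (auto simp: fun_eq_iff algebra_simps)

lemma cl_elem_diff: "cl_elem n U \<Longrightarrow> cl_elem n V \<Longrightarrow> cl_elem n (U - V)"
  and cl_elem_scale: "cl_elem n U \<Longrightarrow> cl_elem n (cl_scale z U)"
  and cl_elem_sum: "(\<And>i. i \<in> I \<Longrightarrow> cl_elem n (F i)) \<Longrightarrow> cl_elem n (\<Sum>i\<in>I. F i)"
  and cl_elem_one: "cl_elem n cl_one"
  and cl_elem_basis: "S \<subseteq> {1..n} \<Longrightarrow> cl_elem n (cl_basis S)"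
  by (auto simp: cl_elem_def cl_one_def cl_basis_def cl_sum_apply)

lemma cl_elem_mult: "cl_elem n (cl_mult n p U V)"
  unfolding cl_elem_def cl_mult_def
  by (intro allI impI sum.neutral ballI) auto

lemmas cl_elem_intros = cl_elem_diff cl_elem_scale cl_elem_sum
  cl_elem_one cl_elem_basis cl_elem_mult

lemma cl_elem_expand:
  assumes "cl_elem n U"
  shows "U = (\<Sum>A\<in>Pow {1..n}. cl_scale (U A) (cl_basis A))"
  using assms by (auto simp: fun_eq_iff cl_elem_def cl_basis_def cl_sum_apply if_distrib cong: if_cong)

lemma cl_mult_add_left: "cl_mult n p (U + V) W = cl_mult n p U W + cl_mult n p V W"
  and cl_mult_add_right: "cl_mult n p W (U + V) = cl_mult n p W U + cl_mult n p W V"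
  and cl_mult_diff_left: "cl_mult n p (U - V) W = cl_mult n p U W - cl_mult n p V W"
  and cl_mult_diff_right: "cl_mult n p W (U - V) = cl_mult n p W U - cl_mult n p W V"
  and cl_mult_scale_left: "cl_mult n p (cl_scale z U) W = cl_scale z (cl_mult n p U W)"
  and cl_mult_scale_right: "cl_mult n p W (cl_scale z U) = cl_scale z (cl_mult n p W U)"
  by (auto simp: cl_mult_def fun_eq_iff sum.distrib[symmetric] sum_subtractf[symmetric]
      sum_distrib_left algebra_simps intro!: sum.cong)

lemma cl_mult_zero_left: "cl_mult n p 0 W = 0"
  using cl_mult_scale_left[of n p 0 0 W] by simp

lemma cl_mult_zero_right: "cl_mult n p W 0 = 0"
  using cl_mult_scale_right[of n p W 0 0] by simp

lemma cl_mult_sum_left: "cl_mult n p (\<Sum>i\<in>I. F i) W = (\<Sum>i\<in>I. cl_mult n p (F i) W)"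
  by (induction I rule: infinite_finite_induct) (simp_all only: sum.infinite sum.empty sum.insert not_False_eq_True cl_mult_add_left cl_mult_zero_left)

lemma cl_mult_sum_right: "cl_mult n p W (\<Sum>i\<in>I. F i) = (\<Sum>i\<in>I. cl_mult n p W (F i))"
  by (induction I rule: infinite_finite_induct) (simp_all only: sum.infinite sum.empty sum.insert not_False_eq_True cl_mult_add_right cl_mult_zero_right)

lemmas cl_mult_linear = cl_mult_add_left cl_mult_add_right cl_mult_diff_left cl_mult_diff_right
  cl_mult_scale_left cl_mult_scale_right cl_mult_zero_left cl_mult_zero_right
  cl_mult_sum_left cl_mult_sum_right

lemma cl_comm_eq: "cl_comm n p U V = cl_mult n p U V - cl_mult n p V U"
  by (simp add: cl_comm_def fun_eq_iff)

lemma cl_mult_expand: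
  "cl_mult n p U V = (\<Sum>A\<in>Pow {1..n}. \<Sum>B\<in>Pow {1..n}.
     cl_scale (cl_sign p A B * U A * V B) (cl_basis (sym_diff A B)))"
  by (auto simp: cl_mult_def cl_basis_def cl_sum_apply fun_eq_iff intro!: sum.cong)

lemma cl_mult_basis:
  assumes "S \<subseteq> {1..n}" "T \<subseteq> {1..n}"
  shows "cl_mult n p (cl_basis S) (cl_basis T) = cl_scale (cl_sign p S T) (cl_basis (sym_diff S T))"
proof
  fix D
  have "cl_mult n p (cl_basis S) (cl_basis T) D =
     (\<Sum>A\<in>Pow {1..n}. \<Sum>B\<in>Pow {1..n}. if A = S then (if B = T then
       (if sym_diff S T = D then cl_sign p S T else 0) else 0) else 0)"
    unfolding cl_mult_def by (intro sum.cong) (auto simp: cl_basis_def)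
  also have "\<dots> = (if sym_diff S T = D then cl_sign p S T else 0)"
  proof -
    have "(\<Sum>A\<in>Pow {1..n}. \<Sum>B\<in>Pow {1..n}. if A = S then (if B = T then z else 0) else 0) = z" for z :: complex
    proof -
      have "(\<Sum>A\<in>Pow {1..n}. \<Sum>B\<in>Pow {1..n}. if A = S then (if B = T then z else 0) else 0) =
        (\<Sum>A\<in>Pow {1..n}. if A = S then (\<Sum>B\<in>Pow {1..n}. if B = T then z else 0) else 0)"
        by (intro sum.cong) auto
      then show ?thesis using assms by simp
    qed
    then show ?thesis .
  qed
  finally show "cl_mult n p (cl_basis S) (cl_basis T) D =
      cl_scale (cl_sign p S T) (cl_basis (sym_diff S T)) D"
    by (auto simp: cl_basis_def)
qed

text \<open>Symmetric difference is a group operation, so each \<open>A\<close> has a single partner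
  \<open>B\<close> contributing to \<open>D\<close>.\<close>

lemma cl_mult_apply:
  assumes "D \<subseteq> {1..n}"
  shows "cl_mult n p U V D =
    (\<Sum>A\<in>Pow {1..n}. cl_sign p A (sym_diff A D) * U A * V (sym_diff A D))"
  unfolding cl_mult_def
proof (rule sum.cong[OF refl])
  fix A assume "A \<in> Pow {1..n}"
  have "(\<Sum>B\<in>Pow {1..n}. if sym_diff A B = D then cl_sign p A B * U A * V B else 0) =
      (\<Sum>B\<in>Pow {1..n}. if B = sym_diff A D then cl_sign p A B * U A * V B else 0)"
    by (simp add: sym_diff_eq_iff)
  also have "\<dots> = cl_sign p A (sym_diff A D) * U A * V (sym_diff A D)"
    using assms \<open>A \<in> Pow {1..n}\<close> by (subst sum.delta) auto
  finally show "(\<Sum>B\<in>Pow {1..n}. if sym_diff A B = D then cl_sign p A B * U A * V B else 0) =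
      cl_sign p A (sym_diff A D) * U A * V (sym_diff A D)" .
qed

text \<open>On basis elements both bracketings carry the sign of (A, B) times that of (A, C) times
  that of (B, C). Multilinearity does the rest.\<close>

lemma cl_mult_assoc:
  assumes "cl_elem n U" "cl_elem n V" "cl_elem n W"
  shows "cl_mult n p (cl_mult n p U V) W = cl_mult n p U (cl_mult n p V W)"
proof -
  have basis: "cl_mult n p (cl_mult n p (cl_basis A) (cl_basis B)) (cl_basis C) =
      cl_mult n p (cl_basis A) (cl_mult n p (cl_basis B) (cl_basis C))"
    if "A \<subseteq> {1..n}" "B \<subseteq> {1..n}" "C \<subseteq> {1..n}" for A B C
  proof -
    have fin: "finite A" "finite B" "finite C"
      using that by (auto intro: finite_subset)
    have sub: "sym_diff A B \<subseteq> {1..n}" "sym_diff B C \<subseteq> {1..n}"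
      using that by auto
    show ?thesis
      by (simp only: cl_mult_basis that sub cl_mult_linear cl.scale_scale
          cl_sign_sym_diff_left[OF fin] cl_sign_sym_diff_right[OF fin] sym_diff_assoc mult_ac)
  qed
  have "cl_mult n p (cl_mult n p (\<Sum>A\<in>Pow {1..n}. cl_scale (U A) (cl_basis A))
        (\<Sum>A\<in>Pow {1..n}. cl_scale (V A) (cl_basis A))) (\<Sum>A\<in>Pow {1..n}. cl_scale (W A) (cl_basis A)) =
      cl_mult n p (\<Sum>A\<in>Pow {1..n}. cl_scale (U A) (cl_basis A))
        (cl_mult n p (\<Sum>A\<in>Pow {1..n}. cl_scale (V A) (cl_basis A)) (\<Sum>A\<in>Pow {1..n}. cl_scale (W A) (cl_basis A)))"
    by (simp add: cl_mult_linear basis)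
  then show ?thesis
    using assms by (simp only: cl_elem_expand[symmetric])
qed

lemma cl_one_basis: "cl_one = cl_basis {}"
  by (simp add: cl_one_def cl_basis_def)

lemma cl_mult_one_left:
  assumes "cl_elem n U" shows "cl_mult n p cl_one U = U"
proof -
  have "cl_mult n p cl_one (\<Sum>A\<in>Pow {1..n}. cl_scale (U A) (cl_basis A)) = (\<Sum>A\<in>Pow {1..n}. cl_scale (U A) (cl_basis A))"
    by (simp add: cl_mult_linear cl_one_basis cl_mult_basis)
  then show ?thesis using assms by (simp only: cl_elem_expand[symmetric])
qed

lemma cl_mult_one_right:
  assumes "cl_elem n U" shows "cl_mult n p U cl_one = U"
proof -
  have "cl_mult n p (\<Sum>A\<in>Pow {1..n}. cl_scale (U A) (cl_basis A)) cl_one = (\<Sum>A\<in>Pow {1..n}. cl_scale (U A) (cl_basis A))"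
    by (simp add: cl_mult_linear cl_one_basis cl_mult_basis)
  then show ?thesis using assms by (simp only: cl_elem_expand[symmetric])
qed

text \<open>Only equal index sets multiply to a multiple of \<open>e\<close>, so the trace form is
  diagonal with nonzero entries.\<close>

lemma cl_tr_mult: "cl_tr (cl_mult n p U V) = (\<Sum>A\<in>Pow {1..n}. cl_sign p A A * U A * V A)"
  by (simp add: cl_tr_def cl_mult_apply)

lemma cl_tr_mult_commute: "cl_tr (cl_mult n p U V) = cl_tr (cl_mult n p V U)"
  by (simp add: cl_tr_mult mult_ac)

lemma cl_tr_scale: "cl_tr (cl_scale z U) = z * cl_tr U"
  by (simp add: cl_tr_def)

text \<open>Nondegeneracy of the trace form in usable shape: pairing with \<open>e_S\<close> reads
  off a coefficient up to sign.\<close>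

lemma cl_tr_mult_basis:
  assumes "S \<subseteq> {1..n}"
  shows "cl_tr (cl_mult n p U (cl_basis S)) = cl_sign p S S * U S"
  using assms by (simp add: cl_tr_mult cl_basis_def if_distrib cong: if_cong)

lemma cl_mult_basis_right_apply:
  assumes "A \<subseteq> {1..n}" "T \<subseteq> {1..n}"
  shows "cl_mult n p U (cl_basis T) (sym_diff A T) = cl_sign p A T * U A"
proof -
  have "sym_diff A T \<subseteq> {1..n}" using assms by auto
  then have "cl_mult n p U (cl_basis T) (sym_diff A T) =
      (\<Sum>B\<in>Pow {1..n}. if B = A then cl_sign p A T * U A else 0)"
    by (simp only: cl_mult_apply)
       (intro sum.cong, auto simp: cl_basis_def sym_diff_eq_iff sym_diff_assoc[symmetric])
  then show ?thesis using assms by simp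
qed

lemma cl_mult_basis_left_apply:
  assumes "A \<subseteq> {1..n}" "T \<subseteq> {1..n}"
  shows "cl_mult n p (cl_basis T) U (sym_diff A T) = cl_sign p T A * U A"
proof -
  have "sym_diff A T \<subseteq> {1..n}" using assms by auto
  moreover have "sym_diff T (sym_diff A T) = A" by blast
  ultimately have "cl_mult n p (cl_basis T) U (sym_diff A T) =
      (\<Sum>B\<in>Pow {1..n}. if B = T then cl_sign p T A * U A else 0)"
    by (simp only: cl_mult_apply) (intro sum.cong, auto simp: cl_basis_def)
  then show ?thesis using assms by simp
qed

section \<open>Commutation signs, the center, and the eigenvalues\<close>

text \<open>For even \<open>card S\<close> any element of \<open>S\<close> serves; for odd
  \<open>card S\<close> any index outside \<open>S\<close> does. Such an index exists because an odd
  \<open>S\<close> equal to \<open>{1..n}\<close> would force \<open>n\<close> odd.\<close>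

lemma exists_anticommuting_index:
  assumes "S \<subseteq> {1..n}" "S \<noteq> {}" "odd n \<longrightarrow> S \<noteq> {1..n}"
  obtains r where "r \<in> {1..n}" "cl_sign p {r} S * cl_sign p S {r} = -1"
proof -
  have fin: "finite S" using assms(1) finite_subset by blast
  have "\<exists>r\<in>{1..n}. odd (card S + (if r \<in> S then 1 else 0))"
  proof (cases "even (card S)")
    case True
    then show ?thesis using assms by fastforce
  next
    case False
    then have "S \<noteq> {1..n}" using assms(3) by auto
    then obtain r where "r \<in> {1..n}" "r \<notin> S" using assms(1) by blast
    then show ?thesis using False by (intro bexI[of _ r]) auto
  qed
  then show ?thesis
    using that cl_sign_commute_single[OF fin, of p] by fastforce
qed

text \<open>Each generator passes the full product with sign \<open>(-1) ^ (n + 1)\<close>, which is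
  1 for odd \<open>n\<close>; multiply over the elements of \<open>S\<close>.\<close>

lemma cl_sign_full_commute:
  assumes "odd n" "S \<subseteq> {1..n}"
  shows "cl_sign p {1..n} S = cl_sign p S {1..n}"
proof -
  have fin: "finite S" using assms(2) finite_subset by blast
  have "cl_sign p S {1..n} * cl_sign p {1..n} S =
      (\<Prod>r\<in>S. cl_sign p {r} {1..n} * cl_sign p {1..n} {r})"
    using fin prod.swap[of "gen_sign p" S "{1..n}"]
    by (simp add: cl_sign_eq_prod prod.distrib)
  also have "\<dots> = 1"
    using assms by (intro prod.neutral ballI) (auto simp: cl_sign_commute_single)
  finally show ?thesis
    by (metis cl_sign_sq(2) fin finite_atLeastAtMost mult.right_neutral)
qed

text \<open>The rank \<open>k\<close> eigenvalue found in \<open>sum_commutator\<close>; the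
  coefficients in (b) are its reciprocals.\<close>

definition weight :: "nat \<Rightarrow> nat \<Rightarrow> complex" where
  "weight n k = of_int (int n - (-1) ^ k * (int n - 2 * int k))"

lemma mu_coef_weight: "mu_coef n k = 1 / weight n k"
  by (simp add: mu_coef_def weight_def)

text \<open>The value is 2k for even \<open>k\<close> and 2(n - k) for odd \<open>k\<close>. The
  bound \<open>nprime n\<close> excludes \<open>k = n\<close> exactly when \<open>n\<close> is
  odd.\<close>

lemma weight_nonzero:
  assumes "k \<in> {1..nprime n}"
  shows "weight n k \<noteq> 0"
proof -
  have "int n - (-1) ^ k * (int n - 2 * int k) \<noteq> 0"
    using assms by (cases "even k") (auto simp: nprime_def split: if_splits)
  then show ?thesis unfolding weight_def by (simp only: of_int_eq_0_iff not_False_eq_True)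
qed

text \<open>The \<open>card S\<close> indices inside \<open>S\<close> and the
  \<open>n - card S\<close> outside it enter with opposite signs, which produces the factor n -
  2k.\<close>

lemma sum_anticommutation_signs:
  assumes "S \<subseteq> {1..n}"
  shows "(\<Sum>r=1..n. 1 - (-1) ^ (card S + (if r \<in> S then 1 else 0))) = weight n (card S)"
proof -
  have fin: "finite S" using assms finite_subset by blast
  have le: "card S \<le> n" using assms card_mono[of "{1..n}" S] by simp
  have "(\<Sum>r=1..n. 1 - (-1) ^ (card S + (if r \<in> S then 1 else 0)) :: complex) =
      of_nat n - (-1) ^ card S * (\<Sum>r=1..n. if r \<in> S then -1 else 1)"
    by (simp add: sum_subtractf sum_distrib_left) (intro sum.cong, auto simp: One_nat_def)
  also have "(\<Sum>r=1..n. if r \<in> S then -1 else 1 :: complex) = of_nat n - 2 * of_nat (card S)"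
  proof -
    have "{1..n} \<inter> S = S" "{1..n} \<inter> - S = {1..n} - S" using assms by auto
    then show ?thesis
      using fin le assms by (simp add: sum.If_cases card_Diff_subset of_nat_diff)
  qed
  finally show ?thesis by (simp add: weight_def)
qed

section \<open>Clifford frames\<close>

text \<open>The value of a Clifford field vector at one point. All algebra is done here, before any
  differentiation.\<close>

locale clifford_frame =
  fixes n p :: nat and H :: "nat \<Rightarrow> cl"
  assumes elem: "r \<in> {1..n} \<Longrightarrow> cl_elem n (H r)"
    and anticommute: "r \<in> {1..n} \<Longrightarrow> s \<in> {1..n} \<Longrightarrow>
      cl_mult n p (H r) (H s) + cl_mult n p (H s) (H r) =
      cl_scale (2 * (if r = s then eta p r else 0)) cl_one"
    and trace_full: "cl_tr (hprod n p H {1..n}) = 0"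
begin

abbreviation mult :: "cl \<Rightarrow> cl \<Rightarrow> cl" (infixl \<open>\<odot>\<close> 70) where
  "U \<odot> V \<equiv> cl_mult n p U V"

abbreviation hp :: "nat set \<Rightarrow> cl" where
  "hp S \<equiv> hprod n p H S"

lemma square: "r \<in> {1..n} \<Longrightarrow> H r \<odot> H r = cl_scale (eta p r) cl_one"
  using anticommute[of r r] by (simp add: fun_eq_iff mult.assoc)

lemma swap:
  assumes "r \<in> {1..n}" "s \<in> {1..n}" "r \<noteq> s"
  shows "H r \<odot> H s = cl_scale (-1) (H s \<odot> H r)"
proof -
  have "(H r \<odot> H s) A + (H s \<odot> H r) A = 0" for A
    using fun_cong[OF anticommute[OF assms(1,2)], of A] assms(3) by simp
  then show ?thesis by (auto simp: fun_eq_iff eq_neg_iff_add_eq_0)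
qed

lemma hprod_empty: "hp {} = cl_one"
  by (simp add: hprod_def cl_prodlist_def)

lemma hprod_insert_min:
  assumes "finite T" "\<forall>t\<in>T. m < t"
  shows "hp (insert m T) = H m \<odot> hp T"
proof -
  have "m \<notin> T" using assms by auto
  then have "sorted_list_of_set (insert m T) = m # sorted_list_of_set T"
    using assms by (simp add: insort_is_Cons less_imp_le)
  then show ?thesis by (simp add: hprod_def cl_prodlist_def)
qed

lemma cl_elem_hprod: "cl_elem n (hp S)"
  unfolding hprod_def cl_prodlist_def
  by (cases "map H (sorted_list_of_set S)") (auto simp: cl_elem_mult cl_elem_one)

lemma hprod_single: "r \<in> {1..n} \<Longrightarrow> hp {r} = H r"
  by (simp add: hprod_def cl_prodlist_def cl_mult_one_right elem)

lemma cl_sign_single_insert: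
  assumes "finite T" "m \<notin> T"
  shows "cl_sign p {r} (insert m T) = gen_sign p r m * cl_sign p {r} T"
  using assms by (simp add: cl_sign_eq_prod)

lemma cl_sign_single_less: "finite T \<Longrightarrow> \<forall>t\<in>T. r < t \<Longrightarrow> cl_sign p {r} T = 1"
  by (simp add: cl_sign_eq_prod) (intro prod.neutral, auto simp: gen_sign_def)

text \<open>Compare \<open>r\<close> with the smallest index \<open>m\<close> of the product:
  \<open>H r\<close> stays in front, or contracts with an equal factor, or moves past
  \<open>H m\<close> at the cost of a sign and meets the induction hypothesis.\<close>

lemma generator_mult_hprod:
  assumes "T \<subseteq> {1..n}" "r \<in> {1..n}"
  shows "H r \<odot> hp T = cl_scale (cl_sign p {r} T) (hp (sym_diff {r} T))"
proof -
  have "finite T" using assms(1) finite_subset by blast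
  then show ?thesis using assms
  proof (induction T rule: finite_linorder_min_induct)
    case empty
    then show ?case by (simp add: hprod_empty hprod_single cl_mult_one_right elem)
  next
    case (insert m T)
    then have m: "m \<in> {1..n}" "m \<notin> T" and IH: "H r \<odot> hp T = cl_scale (cl_sign p {r} T) (hp (sym_diff {r} T))"
      by auto
    note el = elem[OF m(1)] elem[OF \<open>r \<in> {1..n}\<close>] cl_elem_hprod
    consider "r < m" | "r = m" | "m < r" by linarith
    then show ?case
    proof cases
      case 1
      then have less: "\<forall>t\<in>insert m T. r < t" using insert.hyps by auto
      then have "r \<notin> insert m T" by blast
      then have "sym_diff {r} (insert m T) = insert r (insert m T)" by auto
      then show ?thesis
        using less insert.hyps by (simp add: cl_sign_single_less hprod_insert_min)
    next
      case 2
      have "sym_diff {r} (insert m T) = T" using 2 m by auto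
      moreover have "H r \<odot> (H m \<odot> hp T) = cl_scale (eta p r) (hp T)"
        using 2 el square[OF m(1)] by (simp add: cl_mult_assoc[symmetric] cl_mult_linear cl_mult_one_left)
      moreover have "cl_sign p {r} (insert m T) = eta p r"
        using 2 insert.hyps m by (simp add: cl_sign_single_insert cl_sign_single_less gen_sign_def)
      ultimately show ?thesis using insert.hyps by (simp add: hprod_insert_min)
    next
      case 3
      have less: "\<forall>t\<in>sym_diff {r} T. m < t" using 3 insert.hyps by auto
      have eq: "sym_diff {r} (insert m T) = insert m (sym_diff {r} T)" using 3 m by auto
      have "H r \<odot> (H m \<odot> hp T) = (H r \<odot> H m) \<odot> hp T"
        using el by (simp add: cl_mult_assoc)
      also have "\<dots> = cl_scale (-1) (H m \<odot> (H r \<odot> hp T))"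
        using 3 by (simp only: swap[OF \<open>r \<in> {1..n}\<close> m(1)] cl_mult_scale_left cl_mult_assoc el
            less_imp_neq[symmetric] not_False_eq_True)
      also have "\<dots> = cl_scale (- cl_sign p {r} T) (hp (insert m (sym_diff {r} T)))"
        unfolding IH using insert.hyps less by (simp add: cl_mult_linear hprod_insert_min)
      finally show ?thesis
        unfolding eq using insert.hyps 3 m
        by (simp add: hprod_insert_min cl_sign_single_insert gen_sign_def)
    qed
  qed
qed

text \<open>The structure constants agree with those in \<open>cl_mult_basis\<close>. The induction
  peels off the smallest index of \<open>S\<close> and recombines signs by multiplicativity.\<close>

lemma hprod_mult:
  assumes "S \<subseteq> {1..n}" "T \<subseteq> {1..n}"
  shows "hp S \<odot> hp T = cl_scale (cl_sign p S T) (hp (sym_diff S T))"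
proof -
  have fin: "finite S" "finite T" using assms finite_subset by blast+
  from fin(1) assms(1) show ?thesis
  proof (induction S rule: finite_linorder_min_induct)
    case empty
    then show ?case by (simp add: hprod_empty cl_mult_one_left cl_elem_hprod)
  next
    case (insert m S)
    then have m: "m \<in> {1..n}" "m \<notin> S" by auto
    have sub: "sym_diff S T \<subseteq> {1..n}" using insert.prems assms(2) by auto
    have "sym_diff {m} S = insert m S" using m by auto
    then have sgn: "cl_sign p (insert m S) T = cl_sign p {m} T * cl_sign p S T"
      using cl_sign_sym_diff_left[of "{m}" S T p] insert.hyps fin(2) by simp
    have set: "sym_diff {m} (sym_diff S T) = sym_diff (insert m S) T" using m by auto
    have "hp (insert m S) \<odot> hp T = H m \<odot> (hp S \<odot> hp T)"
      using insert.hyps m by (simp add: hprod_insert_min cl_mult_assoc elem cl_elem_hprod)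
    also have "\<dots> = cl_scale (cl_sign p S T) (H m \<odot> hp (sym_diff S T))"
      using insert.IH insert.prems by (simp only: cl_mult_linear insert_subset)
    also have "\<dots> = cl_scale (cl_sign p S T * cl_sign p {m} (sym_diff S T)) (hp (sym_diff (insert m S) T))"
      by (simp only: generator_mult_hprod[OF sub m(1)] set cl.scale_scale)
    also have "cl_sign p {m} (sym_diff S T) = cl_sign p {m} S * cl_sign p {m} T"
      using insert.hyps fin by (intro cl_sign_sym_diff_right) auto
    also have "cl_sign p {m} S = 1"
      using insert.hyps by (intro cl_sign_single_less) auto
    finally show ?case by (simp add: sgn mult.commute)
  qed
qed

text \<open>If \<open>H r\<close> anticommutes with \<open>hp S\<close>, then cyclicity of the trace
  for the factors \<open>hp {r}\<close> and \<open>hp {r} \<odot> hp S\<close> equates a nonzero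
  multiple of the trace with its negative. The full product is covered by
  \<open>trace_full\<close>.\<close>

lemma trace_hprod:
  assumes "S \<subseteq> {1..n}" "S \<noteq> {}"
  shows "cl_tr (hp S) = 0"
proof (cases "S = {1..n}")
  case True
  then show ?thesis by (simp add: trace_full)
next
  case False
  then obtain r where r: "r \<in> {1..n}" and anti: "cl_sign p {r} S * cl_sign p S {r} = -1"
    using exists_anticommuting_index[OF assms] by metis
  have sub: "sym_diff {r} S \<subseteq> {1..n}" "{r} \<subseteq> {1..n}" using r assms by auto
  have fin: "finite S" using assms(1) finite_subset by blast
  have id: "sym_diff {r} (sym_diff {r} S) = S" "sym_diff (sym_diff {r} S) {r} = S" by auto
  have left: "hp {r} \<odot> (hp {r} \<odot> hp S) = cl_scale (cl_sign p {r} {r}) (hp S)"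
  proof -
    have "hp {r} \<odot> (hp {r} \<odot> hp S) =
        cl_scale (cl_sign p {r} S * cl_sign p {r} (sym_diff {r} S)) (hp S)"
      by (simp only: hprod_mult sub assms cl_mult_linear id cl.scale_scale)
    also have "cl_sign p {r} S * cl_sign p {r} (sym_diff {r} S) = cl_sign p {r} {r}"
      using fin by (subst cl_sign_sym_diff_right) (auto simp: cl_sign_sq mult_ac)
    finally show ?thesis .
  qed
  have right: "(hp {r} \<odot> hp S) \<odot> hp {r} = cl_scale (- cl_sign p {r} {r}) (hp S)"
  proof -
    have "(hp {r} \<odot> hp S) \<odot> hp {r} =
        cl_scale (cl_sign p {r} S * cl_sign p (sym_diff {r} S) {r}) (hp S)"
      by (simp only: hprod_mult sub assms cl_mult_linear id cl.scale_scale)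
    also have "cl_sign p {r} S * cl_sign p (sym_diff {r} S) {r} =
        cl_sign p {r} {r} * (cl_sign p {r} S * cl_sign p S {r})"
      using fin by (subst cl_sign_sym_diff_left) auto
    finally show ?thesis by (simp only: anti mult_minus1_right)
  qed
  have "cl_sign p {r} {r} * cl_tr (hp S) = - cl_sign p {r} {r} * cl_tr (hp S)"
    using cl_tr_mult_commute[of n p "hp {r}" "hp {r} \<odot> hp S"]
    unfolding left right cl_tr_scale .
  then show ?thesis using cl_sign_nonzero[of "{r}" "{r}" p] by simp
qed

section \<open>The automorphism carrying the standard basis to the frame basis\<close>

text \<open>Linear extension of \<open>e_S\<close> to \<open>h_S\<close>. It ignores coefficients
  off \<open>Pow {1..n}\<close>, so injectivity is stated for arguments satisfying
  \<open>cl_elem\<close>.\<close>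

definition hcomb :: "cl \<Rightarrow> cl" where
  "hcomb c = (\<Sum>S\<in>Pow {1..n}. cl_scale (c S) (hp S))"

lemma hcomb_sum: "hcomb (\<Sum>i\<in>I. F i) = (\<Sum>i\<in>I. hcomb (F i))"
  unfolding hcomb_def by (subst sum.swap) (simp only: cl_sum_apply cl.scale_sum_left)

lemma hcomb_scale: "hcomb (cl_scale z c) = cl_scale z (hcomb c)"
  by (simp add: hcomb_def cl.scale_sum_right)

lemma hcomb_diff: "hcomb (c - d) = hcomb c - hcomb d"
  by (simp add: hcomb_def cl.scale_left_diff_distrib sum_subtractf)

lemma hcomb_basis:
  assumes "S \<subseteq> {1..n}" shows "hcomb (cl_basis S) = hp S"
proof -
  have "hcomb (cl_basis S) = (\<Sum>T\<in>Pow {1..n}. if T = S then hp S else 0)"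
    unfolding hcomb_def by (intro sum.cong) (auto simp: cl_basis_def)
  then show ?thesis using assms by (simp only: sum.delta' finite_Pow_iff finite_atLeastAtMost Pow_iff if_True sum.delta)
qed

lemma hcomb_mult: "hcomb (c \<odot> d) = hcomb c \<odot> hcomb d"
proof -
  have "hcomb (c \<odot> d) = (\<Sum>A\<in>Pow {1..n}. \<Sum>B\<in>Pow {1..n}.
      cl_scale (cl_sign p A B * c A * d B) (hcomb (cl_basis (sym_diff A B))))"
    unfolding cl_mult_expand[of n p c d] hcomb_sum hcomb_scale ..
  also have "\<dots> = (\<Sum>A\<in>Pow {1..n}. \<Sum>B\<in>Pow {1..n}. cl_scale (c A * d B) (hp A \<odot> hp B))"
  proof (intro sum.cong refl)
    fix A B assume "A \<in> Pow {1..n}" "B \<in> Pow {1..n}"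
    then have *: "A \<subseteq> {1..n}" "B \<subseteq> {1..n}" "sym_diff A B \<subseteq> {1..n}" by auto
    show "cl_scale (cl_sign p A B * c A * d B) (hcomb (cl_basis (sym_diff A B))) =
        cl_scale (c A * d B) (hp A \<odot> hp B)"
      by (simp only: hcomb_basis hprod_mult * cl.scale_scale mult_ac)
  qed
  also have "\<dots> = hcomb c \<odot> hcomb d"
    unfolding hcomb_def
    by (simp only: cl_mult_sum_left)
       (simp only: cl_mult_sum_right cl_mult_scale_left cl_mult_scale_right cl.scale_scale mult.commute)
  finally show ?thesis .
qed

lemma hcomb_comm: "hcomb (cl_comm n p c d) = cl_comm n p (hcomb c) (hcomb d)"
  by (simp add: cl_comm_eq hcomb_diff hcomb_mult)

lemma trace_hcomb: "cl_tr (hcomb c) = cl_tr c"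
proof -
  have "cl_tr (hcomb c) = (\<Sum>S\<in>Pow {1..n}. c S * cl_tr (hp S))"
    by (simp add: hcomb_def cl_tr_def cl_sum_apply)
  also have "\<dots> = (\<Sum>S\<in>Pow {1..n}. if S = {} then c {} else 0)"
    by (intro sum.cong) (use trace_hprod in \<open>auto simp: hprod_empty cl_tr_def cl_one_def\<close>)
  finally show ?thesis by (simp add: cl_tr_def)
qed

text \<open>The kernel is closed under multiplication by \<open>e_S\<close>, and the trace is
  preserved; hence the trace of \<open>c \<odot> cl_basis S\<close>, which is the coefficient up to
  sign, vanishes.\<close>

lemma hcomb_eq_0_imp:
  assumes "hcomb c = 0" "S \<subseteq> {1..n}"
  shows "c S = 0"
proof -
  have "cl_sign p S S * c S = cl_tr (hcomb (c \<odot> cl_basis S))"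
    by (simp add: trace_hcomb cl_tr_mult_basis assms)
  also have "\<dots> = 0" by (simp add: hcomb_mult assms cl_mult_zero_left cl_tr_def)
  finally show ?thesis
    using assms(2) cl_sign_nonzero[of S S p] finite_subset[of S "{1..n}"] by auto
qed

lemma hcomb_inject:
  assumes "hcomb c = hcomb d" "cl_elem n c" "cl_elem n d"
  shows "c = d"
proof
  fix S
  show "c S = d S"
  proof (cases "S \<subseteq> {1..n}")
    case True
    have "hcomb (c - d) = 0" by (simp add: hcomb_diff assms)
    from hcomb_eq_0_imp[OF this True] show ?thesis by simp
  qed (use assms in \<open>simp add: cl_elem_def\<close>)
qed

lemma inj_on_hprod: "inj_on hp (Pow {1..n})"
proof (rule inj_onI)
  fix S T assume *: "S \<in> Pow {1..n}" "T \<in> Pow {1..n}" "hp S = hp T"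
  then have "hcomb (cl_basis S) = hcomb (cl_basis T)" by (simp add: hcomb_basis)
  then have "cl_basis S = cl_basis T"
    by (rule hcomb_inject) (use * in \<open>auto intro: cl_elem_basis\<close>)
  from fun_cong[OF this, of S] show "S = T" by (simp add: cl_basis_def split: if_splits)
qed

lemma sum_image_hprod:
  "(\<Sum>v\<in>hp ` Pow {1..n}. cl_scale (f v) v) = hcomb (\<lambda>S. f (hp S))"
  unfolding hcomb_def by (subst sum.reindex[OF inj_on_hprod]) simp

lemma independent_hprod: "cl.independent (hp ` Pow {1..n})"
proof (rule cl.independent_if_scalars_zero)
  fix f v assume "(\<Sum>v\<in>hp ` Pow {1..n}. cl_scale (f v) v) = 0" "v \<in> hp ` Pow {1..n}"
  then show "f v = 0" unfolding sum_image_hprod by (auto dest: hcomb_eq_0_imp)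
qed simp

text \<open>An element outside the span of the \<open>h_S\<close> would enlarge them to more
  independent vectors than the standard basis of the algebra allows.\<close>

lemma hcomb_surj:
  assumes "cl_elem n U"
  obtains c where "cl_elem n c" "hcomb c = U"
proof -
  let ?B = "hp ` Pow {1..n}" and ?E = "cl_basis ` Pow {1..n}"
  have span_E: "V \<in> cl.span ?E" if "cl_elem n V" for V
    by (subst cl_elem_expand[OF that])
       (intro cl.span_sum cl.span_scale cl.span_base imageI)
  have "U \<in> cl.span ?B"
  proof (rule ccontr)
    assume U: "U \<notin> cl.span ?B"
    then have "cl.independent (insert U ?B)"
      by (intro cl.independent_insertI independent_hprod)
    moreover have "insert U ?B \<subseteq> cl.span ?E"
      using assms cl_elem_hprod span_E by auto
    ultimately have "card (insert U ?B) \<le> card ?E"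
      using cl.independent_span_bound[of ?E "insert U ?B"] by simp
    also have "\<dots> \<le> card (Pow {1..n})" by (intro card_image_le) simp
    also have "\<dots> = card ?B" by (simp add: card_image[OF inj_on_hprod])
    finally show False
      using U cl.span_base[of U ?B] by (auto simp: card_insert_if split: if_splits)
  qed
  then obtain f where "U = (\<Sum>v\<in>?B. cl_scale (f v) v)"
    by (auto simp: cl.span_finite)
  then have U: "U = hcomb (\<lambda>S. f (hp S))" by (simp add: sum_image_hprod)
  show ?thesis
  proof
    \<comment> \<open>Values off the subsets of \<open>{1..n}\<close> are reset to 0 to satisfy
      \<open>cl_elem\<close>; \<open>hcomb\<close> does not see them.\<close>
    let ?c = "\<lambda>S. if S \<subseteq> {1..n} then f (hp S) else 0"
    show "cl_elem n ?c" by (simp add: cl_elem_def)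
    show "hcomb ?c = U" unfolding U hcomb_def by (intro sum.cong) auto
  qed
qed

text \<open>Injectivity makes the definite description in \<open>hcoeffs\<close> well defined, so it
  inverts \<open>hcomb\<close>.\<close>

lemma hcoeffs_hcomb:
  assumes "cl_elem n c" shows "hcoeffs n p H (hcomb c) = c"
proof -
  have eq: "(\<lambda>A. \<Sum>S\<in>Pow {1..n}. d S * hp S A) = hcomb d" for d
    by (simp add: hcomb_def fun_eq_iff cl_sum_apply)
  show ?thesis
    unfolding hcoeffs_def eq cl_elem_def[symmetric]
    by (rule the_equality) (use assms hcomb_inject in auto)
qed

lemma hproj_hcomb:
  assumes "cl_elem n c"
  shows "hproj n p H k (hcomb c) = (\<Sum>S\<in>{S\<in>Pow {1..n}. card S = k}. cl_scale (c S) (hp S))"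
  by (simp add: hproj_def hcoeffs_hcomb[OF assms] fun_eq_iff cl_sum_apply)

section \<open>The center seen from the frame basis\<close>

lemma hprod_full_central:
  assumes "odd n" "cl_elem n U"
  shows "U \<odot> hp {1..n} = hp {1..n} \<odot> U"
proof -
  obtain c where c: "cl_elem n c" "hcomb c = U" using hcomb_surj assms(2) by blast
  have "hp S \<odot> hp {1..n} = hp {1..n} \<odot> hp S" if "S \<subseteq> {1..n}" for S
    using that assms(1) by (simp add: hprod_mult cl_sign_full_commute Un_commute)
  then show ?thesis
    unfolding c(2)[symmetric] hcomb_def by (simp add: cl_mult_linear)
qed

text \<open>Transfers the centerless condition from the standard basis to the frame basis. The
  identity part is the trace. For odd \<open>n\<close> the full product \<open>h_{1..n}\<close>
  turns out to be a multiple of \<open>e_{1..n}\<close>, so pairing with it tests the same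
  coefficient in both bases.\<close>

lemma centerless_hcomb:
  assumes "cl_centerless n (hcomb c)"
  shows "c {} = 0" "odd n \<Longrightarrow> c {1..n} = 0"
proof -
  show "c {} = 0" using assms trace_hcomb[of c] by (simp add: cl_centerless_def cl_tr_def)
  assume odd: "odd n"
  let ?Z = "hp {1..n}"
  \<comment> \<open>Centrality kills every coefficient at a set \<open>A\<close> with an
    anticommuting generator; the empty set is handled by \<open>trace_full\<close>.\<close>
  have Z: "?Z A = 0" if A: "A \<subseteq> {1..n}" "A \<noteq> {1..n}" for A
  proof (cases "A = {}")
    case True
    then show ?thesis using trace_full by (simp add: cl_tr_def)
  next
    case False
    then obtain r where r: "r \<in> {1..n}" and anti: "cl_sign p {r} A * cl_sign p A {r} = -1"
      using exists_anticommuting_index A by metis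
    have sub: "{r} \<subseteq> {1..n}" using r by auto
    have fin: "finite A" using A(1) finite_subset by blast
    have "cl_basis {r} \<odot> ?Z = ?Z \<odot> cl_basis {r}"
      using sub by (intro hprod_full_central odd cl_elem_basis)
    then have "cl_sign p {r} A * ?Z A = cl_sign p A {r} * ?Z A"
      using cl_mult_basis_left_apply[OF A(1) sub, of p ?Z]
        cl_mult_basis_right_apply[OF A(1) sub, of p ?Z] by metis
    then have "cl_sign p {r} A * (cl_sign p {r} A * ?Z A) = cl_sign p {r} A * cl_sign p A {r} * ?Z A"
      by simp
    then show ?thesis using fin by (simp add: anti cl_sign_sq)
  qed
  have "cl_sign p {1..n} {1..n} * c {1..n} = cl_tr (hcomb (c \<odot> cl_basis {1..n}))"
    by (simp add: trace_hcomb cl_tr_mult_basis)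
  also have "\<dots> = cl_tr (hcomb c \<odot> ?Z)" by (simp add: hcomb_mult hcomb_basis)
  also have "\<dots> = 0"
    unfolding cl_tr_mult using Z assms odd
    by (intro sum.neutral) (auto simp: cl_centerless_def)
  finally show "c {1..n} = 0" using cl_sign_nonzero[of "{1..n}" "{1..n}" p] by simp
qed

section \<open>Diagonalizing the commutator sum and inverting it\<close>

text \<open>Since \<open>eta p r\<close> times the square of \<open>e_r\<close> is the identity,
  each \<open>r\<close> contributes 0 if \<open>e_r\<close> commutes with \<open>e_S\<close> and 2
  if it anticommutes.\<close>

lemma sum_commutator_basis:
  assumes "S \<subseteq> {1..n}"
  shows "(\<Sum>r=1..n. cl_scale (eta p r) (cl_comm n p (cl_basis S) (cl_basis {r}) \<odot> cl_basis {r})) =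
    cl_scale (weight n (card S)) (cl_basis S)"
proof -
  have fin: "finite S" using assms finite_subset by blast
  have "cl_scale (eta p r) (cl_comm n p (cl_basis S) (cl_basis {r}) \<odot> cl_basis {r}) =
      cl_scale (1 - (-1) ^ (card S + (if r \<in> S then 1 else 0))) (cl_basis S)"
    if "r \<in> {1..n}" for r
  proof -
    have sub: "{r} \<subseteq> {1..n}" "sym_diff S {r} \<subseteq> {1..n}" "sym_diff {r} S \<subseteq> {1..n}"
      using that assms by auto
    have id: "sym_diff (sym_diff S {r}) {r} = S" "sym_diff (sym_diff {r} S) {r} = S" by auto
    have rr: "cl_sign p {r} {r} = eta p r" by (simp add: cl_sign_eq_prod gen_sign_def)
    have sign1: "cl_sign p (sym_diff S {r}) {r} = cl_sign p S {r} * eta p r"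
      using fin by (subst cl_sign_sym_diff_left) (auto simp: rr)
    have sign2: "cl_sign p (sym_diff {r} S) {r} = eta p r * cl_sign p S {r}"
      using fin by (subst cl_sign_sym_diff_left) (auto simp: rr)
    have "cl_basis S \<odot> cl_basis {r} \<odot> cl_basis {r} = cl_scale (eta p r) (cl_basis S)"
      using fin by (simp only: cl_mult_basis assms sub cl_mult_scale_left id cl.scale_scale sign1
          cl_sign_sq finite.intros)
    moreover have "cl_basis {r} \<odot> cl_basis S \<odot> cl_basis {r} =
        cl_scale (eta p r * (-1) ^ (card S + (if r \<in> S then 1 else 0))) (cl_basis S)"
      by (simp only: cl_mult_basis assms sub cl_mult_scale_left id cl.scale_scale sign2
          cl_sign_commute_single[OF fin, of p r, symmetric]) (simp only: mult_ac)
    ultimately show ?thesis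
      by (simp only: cl_comm_eq cl_mult_diff_left cl.scale_right_diff_distrib cl.scale_scale
          eta_sq cl.scale_left_diff_distrib)
  qed
  then have "(\<Sum>r=1..n. cl_scale (eta p r) (cl_comm n p (cl_basis S) (cl_basis {r}) \<odot> cl_basis {r})) =
      (\<Sum>r=1..n. cl_scale (1 - (-1) ^ (card S + (if r \<in> S then 1 else 0))) (cl_basis S))"
    by (rule sum.cong[OF refl])
  also have "\<dots> = cl_scale (\<Sum>r=1..n. 1 - (-1) ^ (card S + (if r \<in> S then 1 else 0))) (cl_basis S)"
    by (simp only: cl.scale_sum_left)
  also have "\<dots> = cl_scale (weight n (card S)) (cl_basis S)"
    by (simp only: sum_anticommutation_signs[OF assms])
  finally show ?thesis .
qed

lemma sum_commutator:
  assumes "cl_elem n c"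
  shows "(\<Sum>r=1..n. cl_scale (eta p r) (cl_comm n p c (cl_basis {r}) \<odot> cl_basis {r})) =
    (\<lambda>S. weight n (card S) * c S)"
proof -
  define L where "L c = (\<Sum>r=1..n. cl_scale (eta p r) (cl_comm n p c (cl_basis {r}) \<odot> cl_basis {r}))" for c
  have L_scale: "L (cl_scale z c) = cl_scale z (L c)" for z c
    unfolding L_def cl_comm_eq cl_mult_scale_left cl_mult_scale_right cl_mult_diff_left
      cl.scale_right_diff_distrib cl.scale_sum_right cl.scale_scale
    by (simp only: mult.commute)
  have L_sum: "L (\<Sum>i\<in>I. F i) = (\<Sum>i\<in>I. L (F i))" for F :: "nat set \<Rightarrow> cl" and I
    unfolding L_def cl_comm_eq cl_mult_sum_left cl_mult_sum_right cl_mult_diff_left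
      cl.scale_right_diff_distrib cl.scale_sum_right
    by (subst sum.swap) (simp only: sum_subtractf cl.scale_sum_right cl_mult_sum_left)
  have "L c = L (\<Sum>S\<in>Pow {1..n}. cl_scale (c S) (cl_basis S))"
    using cl_elem_expand[OF assms] by (rule arg_cong)
  also have "\<dots> = (\<Sum>S\<in>Pow {1..n}. cl_scale (c S) (L (cl_basis S)))"
    by (simp only: L_sum L_scale)
  also have "\<dots> = (\<Sum>S\<in>Pow {1..n}. cl_scale (weight n (card S) * c S) (cl_basis S))"
    unfolding L_def
    by (intro sum.cong refl) (simp only: Pow_iff sum_commutator_basis cl.scale_scale mult.commute)
  also have "\<dots> = (\<lambda>S. weight n (card S) * c S)"
    by (rule cl_elem_expand[symmetric]) (use assms in \<open>simp add: cl_elem_def\<close>)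
  finally show ?thesis unfolding L_def .
qed

text \<open>Pulled back along \<open>hcomb\<close>, the argument of the projections is
  \<open>c\<close> with rank \<open>k\<close> scaled by its eigenvalue. The factors
  \<open>mu_coef\<close> undo this, and \<open>c\<close> vanishes in the ranks outside
  \<open>{1..nprime n}\<close>.\<close>

lemma recover_from_commutators:
  assumes c: "cl_elem n c" "c {} = 0" "odd n \<Longrightarrow> c {1..n} = 0"
    and D: "\<And>r. r \<in> {1..n} \<Longrightarrow> D r = cl_comm n p (hcomb c) (H r)"
  shows "(\<Sum>k=1..nprime n. cl_scale (mu_coef n k)
      (hproj n p H k (\<Sum>r=1..n. D r \<odot> cl_scale (eta p r) (H r)))) = hcomb c"
proof -
  let ?d = "\<lambda>S. weight n (card S) * c S"
  have H: "H r = hcomb (cl_basis {r})" if "r \<in> {1..n}" for r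
    using that by (simp add: hcomb_basis hprod_single)
  have "(\<Sum>r=1..n. D r \<odot> cl_scale (eta p r) (H r)) =
      (\<Sum>r=1..n. hcomb (cl_scale (eta p r) (cl_comm n p c (cl_basis {r}) \<odot> cl_basis {r})))"
    by (intro sum.cong refl) (simp only: D H hcomb_comm hcomb_mult hcomb_scale cl_mult_scale_right)
  also have "\<dots> = hcomb ?d"
    by (simp only: hcomb_sum[symmetric] sum_commutator[OF c(1)])
  finally have W: "(\<Sum>r=1..n. D r \<odot> cl_scale (eta p r) (H r)) = hcomb ?d" .
  have d: "cl_elem n ?d" using c(1) by (simp add: cl_elem_def)
  have "(\<Sum>k=1..nprime n. cl_scale (mu_coef n k) (hproj n p H k (hcomb ?d))) =
      (\<Sum>k=1..nprime n. \<Sum>S\<in>Pow {1..n}. if card S = k then cl_scale (mu_coef n k * ?d S) (hp S) else 0)"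
    by (simp only: hproj_hcomb[OF d] cl.scale_sum_right cl.scale_scale)
       (simp only: sum.inter_filter finite_Pow_iff finite_atLeastAtMost)
  also have "\<dots> = (\<Sum>S\<in>Pow {1..n}. \<Sum>k=1..nprime n. if card S = k then cl_scale (mu_coef n k * ?d S) (hp S) else 0)"
    by (rule sum.swap)
  also have "\<dots> = (\<Sum>S\<in>Pow {1..n}. cl_scale (c S) (hp S))"
  proof (rule sum.cong[OF refl])
    fix S assume S: "S \<in> Pow {1..n}"
    have le: "card S \<le> n" using S card_mono[of "{1..n}" S] by auto
    have "(\<Sum>k=1..nprime n. if card S = k then cl_scale (mu_coef n k * ?d S) (hp S) else 0) =
       (if card S \<in> {1..nprime n} then cl_scale (mu_coef n (card S) * ?d S) (hp S) else 0)"
      by (rule sum.delta'[OF finite_atLeastAtMost])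
    also have "\<dots> = cl_scale (c S) (hp S)"
    proof (cases "card S \<in> {1..nprime n}")
      case True
      then have "mu_coef n (card S) * ?d S = c S"
        using weight_nonzero[OF True] by (simp add: mu_coef_weight)
      then show ?thesis using True by (simp only: if_True)
    next
      case False
      \<comment> \<open>A rank outside the range is 0, or \<open>n\<close> with \<open>n\<close>
        odd: precisely the central components assumed to vanish.\<close>
      have "c S = 0"
      proof (cases "card S = 0")
        case True
        then show ?thesis using S c(2) finite_subset[of S "{1..n}"] by auto
      next
        case nz: False
        then have "odd n" "card S = n" using False le by (auto simp: nprime_def split: if_splits)
        then have "S = {1..n}" using S card_subset_eq[of "{1..n}" S] by auto
        then show ?thesis using c(3) \<open>odd n\<close> by simp
      qed
      then show ?thesis using False by (simp only: if_False cl.scale_zero_left)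
    qed
    finally show "(\<Sum>k=1..nprime n. if card S = k then cl_scale (mu_coef n k * ?d S) (hp S) else 0) =
        cl_scale (c S) (hp S)" .
  qed
  finally show ?thesis unfolding W hcomb_def .
qed

text \<open>Here \<open>C'\<close> is any solution of the commutator equations, possibly with a
  central part. It makes the formula produce a solution, which gives the direction from right to
  left.\<close>

lemma commutator_equation_iff:
  assumes C: "cl_elem n C" "cl_centerless n C"
    and C': "cl_elem n C'" "\<And>r. r \<in> {1..n} \<Longrightarrow> D r = cl_comm n p C' (H r)"
  shows "(\<forall>r\<in>{1..n}. D r = cl_comm n p C (H r)) \<longleftrightarrow>
    C = (\<Sum>k=1..nprime n. cl_scale (mu_coef n k)
      (hproj n p H k (\<Sum>r=1..n. D r \<odot> cl_scale (eta p r) (H r))))"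
proof
  assume eq: "\<forall>r\<in>{1..n}. D r = cl_comm n p C (H r)"
  obtain c where c: "cl_elem n c" "hcomb c = C" using hcomb_surj C(1) by blast
  show "C = (\<Sum>k=1..nprime n. cl_scale (mu_coef n k)
      (hproj n p H k (\<Sum>r=1..n. D r \<odot> cl_scale (eta p r) (H r))))"
    unfolding c(2)[symmetric]
    by (rule recover_from_commutators[symmetric])
       (use c centerless_hcomb[of c] C(2) eq in auto)
next
  assume eq: "C = (\<Sum>k=1..nprime n. cl_scale (mu_coef n k)
      (hproj n p H k (\<Sum>r=1..n. D r \<odot> cl_scale (eta p r) (H r))))"
  obtain c where c: "cl_elem n c" "hcomb c = C'" using hcomb_surj C'(1) by blast
  \<comment> \<open>Dropping the central components of \<open>C'\<close> does not change its commutators.\<close>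
  define z where "z = (if odd n then c {1..n} else 0)"
  define c' where "c' = c - cl_scale (c {}) cl_one - cl_scale z (cl_basis {1..n})"
  \<comment> \<open>For \<open>n = 0\<close> the full product would be the identity, of trace 1.
    Hence the two central components sit at distinct index sets.\<close>
  have ne: "{1..n} \<noteq> {}"
    using trace_full hprod_empty by (auto simp only: cl_tr_def cl_one_def if_True refl one_neq_zero)
  have "cl_elem n c'" unfolding c'_def by (intro cl_elem_intros c) auto
  moreover have "c' {} = 0"
    using ne by (simp add: c'_def cl_one_def cl_basis_def)
  moreover have "c' {1..n} = 0" if "odd n"
    using ne that by (simp add: c'_def cl_one_def cl_basis_def z_def)
  moreover have D: "D r = cl_comm n p (hcomb c') (H r)" if r: "r \<in> {1..n}" for r
  proof -
    have one: "hcomb cl_one = cl_one"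
      unfolding cl_one_basis by (simp add: hcomb_basis hprod_empty cl_one_basis)
    have full: "cl_scale z (hp {1..n}) \<odot> H r = H r \<odot> cl_scale z (hp {1..n})"
      using hprod_full_central[OF _ elem[OF r]]
      by (cases "odd n") (simp_all add: z_def cl_mult_linear)
    have "hcomb c' = C' - cl_scale (c {}) cl_one - cl_scale z (hp {1..n})"
      by (simp only: c'_def hcomb_diff hcomb_scale one hcomb_basis c order_refl)
    then have "cl_comm n p (hcomb c') (H r) = cl_comm n p C' (H r)"
      using elem[OF r] full
      by (simp add: cl_comm_eq cl_mult_diff_left cl_mult_diff_right)
         (simp add: cl_mult_scale_left cl_mult_scale_right cl_mult_one_left cl_mult_one_right)
    then show ?thesis using C'(2)[OF r] by simp
  qed
  ultimately have "C = hcomb c'" unfolding eq by (intro recover_from_commutators)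
  then show "\<forall>r\<in>{1..n}. D r = cl_comm n p C (H r)" using D by simp
qed

end

section \<open>Curves of Clifford frames\<close>

definition cl_has_deriv :: "(real \<Rightarrow> cl) \<Rightarrow> cl \<Rightarrow> bool" where
  "cl_has_deriv F F' \<longleftrightarrow> (\<forall>A. ((\<lambda>t. F t A) has_vector_derivative F' A) (at 0))"

lemma cl_has_deriv_unique: "cl_has_deriv F U \<Longrightarrow> cl_has_deriv F V \<Longrightarrow> U = V"
  unfolding cl_has_deriv_def by (auto intro!: ext vector_derivative_unique_at)

lemma cl_has_deriv_const: "cl_has_deriv (\<lambda>t. U) 0"
  by (simp add: cl_has_deriv_def)

lemma cl_has_deriv_scale: "cl_has_deriv F F' \<Longrightarrow> cl_has_deriv (\<lambda>t. cl_scale z (F t)) (cl_scale z F')"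
  unfolding cl_has_deriv_def by (auto intro!: derivative_eq_intros has_vector_derivative_mult_right)

lemma cl_has_deriv_mult:
  assumes "cl_has_deriv F F'" "cl_has_deriv G G'"
  shows "cl_has_deriv (\<lambda>t. cl_mult n p (F t) (G t)) (cl_mult n p F' (G 0) + cl_mult n p (F 0) G')"
  unfolding cl_has_deriv_def
proof
  fix D
  have summand: "((\<lambda>t. if sym_diff A B = D then cl_sign p A B * F t A * G t B else 0) has_vector_derivative
     (if sym_diff A B = D then cl_sign p A B * F' A * G 0 B else 0) +
     (if sym_diff A B = D then cl_sign p A B * F 0 A * G' B else 0)) (at 0)" for A B
  proof (cases "sym_diff A B = D")
    case True
    have "((\<lambda>t. cl_sign p A B * (F t A * G t B)) has_vector_derivative
        cl_sign p A B * (F 0 A * G' B + F' A * G 0 B)) (at 0)"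
      using assms unfolding cl_has_deriv_def
      by (intro has_vector_derivative_mult_right has_vector_derivative_mult) auto
    then show ?thesis using True by (simp add: algebra_simps)
  qed simp
  show "((\<lambda>t. cl_mult n p (F t) (G t) D) has_vector_derivative
      (cl_mult n p F' (G 0) + cl_mult n p (F 0) G') D) (at 0)"
    unfolding cl_mult_def plus_fun_apply sum.distrib[symmetric]
    by (intro has_vector_derivative_sum summand)
qed

lemma cl_elem_deriv:
  assumes "cl_has_deriv F F'" "\<And>t. cl_elem n (F t)"
  shows "cl_elem n F'"
  unfolding cl_elem_def
proof (intro allI impI)
  fix A assume "\<not> A \<subseteq> {1..n}"
  then have "(\<lambda>t. F t A) = (\<lambda>t. 0)" using assms(2) by (auto simp: cl_elem_def)
  then have "((\<lambda>t. 0) has_vector_derivative F' A) (at 0)"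
    using assms(1) unfolding cl_has_deriv_def by metis
  then show "F' A = 0"
    using vector_derivative_unique_at[OF _ has_vector_derivative_const] by blast
qed

text \<open>Existence is enough: \<open>deriv_is_commutator\<close> handles these derivatives only
  through the product rule.\<close>

lemma cl_has_deriv_hprod:
  assumes "\<And>r. r \<in> {1..n} \<Longrightarrow> cl_has_deriv (\<lambda>t. H t r) (D r)" "S \<subseteq> {1..n}"
  shows "\<exists>G. cl_has_deriv (\<lambda>t. hprod n p (H t) S) G"
proof -
  have "\<exists>G. cl_has_deriv (\<lambda>t. cl_prodlist n p (map (H t) xs)) G" if "set xs \<subseteq> {1..n}" for xs
    using that
  proof (induction xs)
    case Nil
    then show ?case using cl_has_deriv_const by (auto simp: cl_prodlist_def)
  next
    case (Cons r xs)
    then obtain G where "cl_has_deriv (\<lambda>t. cl_prodlist n p (map (H t) xs)) G" by auto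
    moreover have "cl_has_deriv (\<lambda>t. H t r) (D r)" using Cons.prems by (intro assms) auto
    ultimately show ?case
      using cl_has_deriv_mult[of "\<lambda>t. H t r"] by (fastforce simp: cl_prodlist_def)
  qed
  moreover have "set (sorted_list_of_set S) \<subseteq> {1..n}"
    using assms(2) finite_subset[of S "{1..n}"] by simp
  ultimately show ?thesis unfolding hprod_def by blast
qed

text \<open>\<open>C = 2\<^sup>-\<^sup>n \<Sum>\<^sub>S (h\<^sub>S)' h\<^sub>S\<^sup>-\<^sup>1\<close> works: expanding \<open>(h\<^sup>r h\<^sub>S)'\<close> by the product rule
  and reindexing \<open>S\<close> to \<open>S \<triangle> {r}\<close>, everything in \<open>[C, h\<^sup>r]\<close> cancels except \<open>(h\<^sup>r)'\<close>.\<close>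

lemma deriv_is_commutator:
  assumes frame: "\<And>t. clifford_frame n p (H t)"
    and D: "\<And>r. r \<in> {1..n} \<Longrightarrow> cl_has_deriv (\<lambda>t. H t r) (D r)"
  obtains C where "cl_elem n C" "\<And>r. r \<in> {1..n} \<Longrightarrow> D r = cl_comm n p C (H 0 r)"
proof -
  interpret clifford_frame n p "H 0" by (rule frame)
  define G where "G S = (SOME g. cl_has_deriv (\<lambda>t. hprod n p (H t) S) g)" for S
  have G: "cl_has_deriv (\<lambda>t. hprod n p (H t) S) (G S)" if "S \<subseteq> {1..n}" for S
    unfolding G_def by (rule someI_ex[OF cl_has_deriv_hprod[OF D that]])
  have elG: "cl_elem n (G S)" if "S \<subseteq> {1..n}" for S
    using G[OF that] clifford_frame.cl_elem_hprod[OF frame] by (rule cl_elem_deriv)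
  have elD: "cl_elem n (D r)" if "r \<in> {1..n}" for r
    using D[OF that] clifford_frame.elem[OF frame that] by (rule cl_elem_deriv)
  \<comment> \<open>The curve \<open>h_r h_S\<close> is differentiated twice: by the product rule,
    and after rewriting it as a constant sign times a single frame product.\<close>
  have leibniz: "H 0 r \<odot> G S = cl_scale (cl_sign p {r} S) (G (sym_diff {r} S)) - D r \<odot> hp S"
    if r: "r \<in> {1..n}" and S: "S \<subseteq> {1..n}" for r S
  proof -
    have sub: "sym_diff {r} S \<subseteq> {1..n}" using r S by auto
    have "cl_has_deriv (\<lambda>t. cl_mult n p (H t r) (hprod n p (H t) S)) (D r \<odot> hp S + H 0 r \<odot> G S)"
      by (rule cl_has_deriv_mult[OF D[OF r] G[OF S]])
    moreover have "cl_has_deriv (\<lambda>t. cl_mult n p (H t r) (hprod n p (H t) S))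
        (cl_scale (cl_sign p {r} S) (G (sym_diff {r} S)))"
      using cl_has_deriv_scale[OF G[OF sub]]
      by (simp only: clifford_frame.generator_mult_hprod[OF frame S r])
    ultimately have "D r \<odot> hp S + H 0 r \<odot> G S = cl_scale (cl_sign p {r} S) (G (sym_diff {r} S))"
      by (rule cl_has_deriv_unique)
    then show ?thesis by (simp only: eq_diff_eq add.commute)
  qed
  \<comment> \<open>The inverse of \<open>h_S\<close> is \<open>cl_sign p S S\<close> times
    \<open>h_S\<close>; the normalization by \<open>2 ^ n\<close> is postponed to the end.\<close>
  define E where "E = (\<Sum>S\<in>Pow {1..n}. cl_scale (cl_sign p S S) (G S \<odot> hp S))"
  have comm: "cl_comm n p E (H 0 r) = cl_scale (2 ^ n) (D r)" if r: "r \<in> {1..n}" for r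
  proof -
    let ?s = "\<lambda>S. sym_diff S {r}"
    let ?f = "\<lambda>S. cl_scale (cl_sign p S S * cl_sign p S {r}) (G S \<odot> hp (?s S))"
    have r': "{r} \<subseteq> {1..n}" using r by simp
    have fin: "finite S" if "S \<in> Pow {1..n}" for S using that finite_subset by auto
    have EH: "E \<odot> H 0 r = (\<Sum>S\<in>Pow {1..n}. ?f S)"
    proof -
      have "(G S \<odot> hp S) \<odot> H 0 r = cl_scale (cl_sign p S {r}) (G S \<odot> hp (?s S))"
        if "S \<in> Pow {1..n}" for S
      proof -
        have S: "S \<subseteq> {1..n}" using that by simp
        have "(G S \<odot> hp S) \<odot> H 0 r = G S \<odot> (hp S \<odot> hp {r})"
          by (simp only: cl_mult_assoc elG[OF S] cl_elem_hprod elem[OF r] hprod_single[OF r])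
        also have "\<dots> = cl_scale (cl_sign p S {r}) (G S \<odot> hp (?s S))"
          by (simp only: hprod_mult[OF S r'] cl_mult_scale_right)
        finally show ?thesis .
      qed
      then show ?thesis
        unfolding E_def cl_mult_sum_left cl_mult_scale_left
        by (intro sum.cong refl) (simp only: cl.scale_scale)
    qed
    have HE: "H 0 r \<odot> E = (\<Sum>S\<in>Pow {1..n}. ?f (?s S) - D r)"
    proof -
      have "cl_scale (cl_sign p S S) (H 0 r \<odot> (G S \<odot> hp S)) = ?f (?s S) - D r"
        if "S \<in> Pow {1..n}" for S
      proof -
        have S: "S \<subseteq> {1..n}" and finS: "finite S" using that fin by auto
        \<comment> \<open>Matches the sign in \<open>H 0 r \<odot> E\<close> at \<open>S\<close>
          with the one in \<open>E \<odot> H 0 r\<close> at \<open>sym_diff S {r}\<close>; the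
          surplus factors occur in pairs.\<close>
        have sgn: "cl_sign p (?s S) (?s S) * cl_sign p (?s S) {r} = cl_sign p S S * cl_sign p {r} S"
        proof -
          have "cl_sign p (?s S) (?s S) = cl_sign p S (?s S) * cl_sign p {r} (?s S)"
            using finS by (intro cl_sign_sym_diff_left) auto
          also have "cl_sign p S (?s S) = cl_sign p S S * cl_sign p S {r}"
            using finS by (intro cl_sign_sym_diff_right) auto
          also have "cl_sign p {r} (?s S) = cl_sign p {r} S * cl_sign p {r} {r}"
            using finS by (intro cl_sign_sym_diff_right) auto
          finally have 1: "cl_sign p (?s S) (?s S) =
              cl_sign p S S * cl_sign p S {r} * (cl_sign p {r} S * cl_sign p {r} {r})" .
          have 2: "cl_sign p (?s S) {r} = cl_sign p S {r} * cl_sign p {r} {r}"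
            using finS by (intro cl_sign_sym_diff_left) auto
          have 3: "cl_sign p S {r} * cl_sign p S {r} = 1" "cl_sign p {r} {r} * cl_sign p {r} {r} = 1"
            using finS by (simp_all only: cl_sign_sq finite.intros)
          have "cl_sign p (?s S) (?s S) * cl_sign p (?s S) {r} = cl_sign p S S * cl_sign p {r} S *
              (cl_sign p S {r} * cl_sign p S {r}) * (cl_sign p {r} {r} * cl_sign p {r} {r})"
            unfolding 1 2 by (simp only: mult_ac)
          then show ?thesis by (simp only: 3 mult_1_right)
        qed
        have sets: "sym_diff {r} S = ?s S" "?s (?s S) = S" by auto
        have "D r \<odot> hp S \<odot> hp S = D r \<odot> (hp S \<odot> hp S)"
          by (simp only: cl_mult_assoc elD[OF r] cl_elem_hprod)
        also have "\<dots> = cl_scale (cl_sign p S S) (D r)"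
          using S elD[OF r] by (simp add: hprod_mult hprod_empty cl_mult_scale_right cl_mult_one_right)
        finally have DSS: "D r \<odot> hp S \<odot> hp S = cl_scale (cl_sign p S S) (D r)" .
        have "H 0 r \<odot> (G S \<odot> hp S) = H 0 r \<odot> G S \<odot> hp S"
          by (simp only: cl_mult_assoc elG[OF S] cl_elem_hprod elem[OF r])
        also have "\<dots> = cl_scale (cl_sign p {r} S) (G (?s S) \<odot> hp S) - cl_scale (cl_sign p S S) (D r)"
          by (simp only: leibniz[OF r S] cl_mult_diff_left cl_mult_scale_left DSS sets)
        finally show ?thesis
          using finS
          by (simp only: cl.scale_right_diff_distrib cl.scale_scale sgn sets cl_sign_sq cl.scale_one)
      qed
      then show ?thesis
        unfolding E_def cl_mult_sum_right cl_mult_scale_right by (rule sum.cong[OF refl])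
    qed
    \<comment> \<open>Toggling \<open>r\<close> is an involution of \<open>Pow {1..n}\<close>, so
      the two sums cancel in the commutator and leave \<open>2 ^ n\<close> copies of
      \<open>D r\<close>.\<close>
    have "(\<Sum>S\<in>Pow {1..n}. ?f (?s S)) = (\<Sum>S\<in>Pow {1..n}. ?f S)"
    proof (rule sum.reindex_bij_witness[of _ ?s ?s])
      show "?f (?s S) = ?f (?s S)" for S ..
    qed (use r in blast)+
    moreover have "(\<Sum>S\<in>Pow {1..n}. D r) = cl_scale (2 ^ n) (D r)"
      by (rule ext, subst cl_sum_apply) (simp add: card_Pow)
    ultimately show ?thesis
      unfolding cl_comm_eq EH HE sum_subtractf by simp
  qed
  show ?thesis
  proof
    show "cl_elem n (cl_scale (1 / 2 ^ n) E)"
      unfolding E_def by (intro cl_elem_intros)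
    fix r assume "r \<in> {1..n}"
    have "cl_comm n p (cl_scale (1 / 2 ^ n) E) (H 0 r) = cl_scale (1 / 2 ^ n) (cl_comm n p E (H 0 r))"
      by (simp only: cl_comm_eq cl_mult_scale_left cl_mult_scale_right cl.scale_right_diff_distrib)
    then show "D r = cl_comm n p (cl_scale (1 / 2 ^ n) E) (H 0 r)"
      using comm[OF \<open>r \<in> {1..n}\<close>] by simp
  qed
qed

section \<open>From field vectors to curves of frames\<close>

lemma clifford_field_vector_frame:
  assumes "clifford_field_vector n p h"
  shows "clifford_frame n p (\<lambda>r. h r x)"
proof
  have "sorted_list_of_set {1..n} = [1..<n+1]"
    by (metis Suc_eq_plus1 atLeastLessThanSuc_atLeastAtMost sorted_list_of_set_range)
  then show "cl_tr (hprod n p (\<lambda>r. h r x) {1..n}) = 0"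
    using assms unfolding clifford_field_vector_def hprod_def by simp
qed (use assms in \<open>auto simp: clifford_field_vector_def plus_fun_def cl_scale_def\<close>)

text \<open>\<open>vector_derivative\<close> is total, so \<open>pd\<close> has its intended meaning
  only once differentiability along the line is known; the chain rule supplies it.\<close>

lemma smooth_cl_has_deriv:
  fixes b :: "nat \<Rightarrow> 'a::euclidean_space"
  assumes "smooth_cl F"
  shows "cl_has_deriv (\<lambda>t. F (x + t *\<^sub>R b m)) (pd b F m x)"
  unfolding cl_has_deriv_def
proof
  fix A
  have "smooth_fun (\<lambda>y. F y A)" using assms by (simp add: smooth_cl_def)
  then have "(\<lambda>y. F y A) differentiable (at (x + 0 *\<^sub>R b m))"
    by (auto elim: smooth_fun.cases)
  moreover have "(\<lambda>t::real. x + t *\<^sub>R b m) differentiable (at 0)"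
    by (auto intro!: derivative_intros)
  ultimately have "(\<lambda>t::real. F (x + t *\<^sub>R b m) A) differentiable (at 0)"
    using differentiable_chain_at[of "\<lambda>t::real. x + t *\<^sub>R b m" 0 "\<lambda>y. F y A"] by (simp add: o_def)
  then show "((\<lambda>t. F (x + t *\<^sub>R b m) A) has_vector_derivative pd b F m x A) (at 0)"
    unfolding pd_def by (simp add: vector_derivative_works)
qed

theorem theorem8:
  fixes p q n :: nat and b :: "nat \<Rightarrow> 'a::euclidean_space"
    and h C :: "nat \<Rightarrow> 'a \<Rightarrow> cl"
  assumes "n = p + q"
    and "bij_betw b {1..n} Basis"
    and "clifford_field_vector n p h"
    and "\<forall>\<mu>\<in>{1..n}. smooth_cl (h \<mu>)"
    and "\<forall>\<mu>\<in>{1..n}. \<forall>x. cl_elem n (C \<mu> x) \<and> cl_centerless n (C \<mu> x)"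
    and "\<forall>\<mu>\<in>{1..n}. smooth_cl (C \<mu>)"
  shows "(\<forall>\<mu>\<in>{1..n}. \<forall>\<rho>\<in>{1..n}. \<forall>x.
            (\<lambda>A. pd b (hlow p h \<rho>) \<mu> x A - cl_comm n p (C \<mu> x) (hlow p h \<rho> x) A) = (\<lambda>A. 0))
     \<longleftrightarrow>
         (\<forall>\<mu>\<in>{1..n}. \<forall>x.
            C \<mu> x = (\<lambda>A. \<Sum>k=1..nprime n. mu_coef n k *
               hproj n p (\<lambda>\<nu>. h \<nu> x) k
                 (\<lambda>D. \<Sum>\<rho>=1..n. cl_mult n p (pd b (h \<rho>) \<mu> x) (hlow p h \<rho> x) D) A))"
proof -
  have low: "hlow p h r x = cl_scale (eta p r) (h r x)" for r x
    by (simp add: hlow_def cl_scale_def)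
  \<comment> \<open>Lowering the index multiplies both terms by the same nonzero constant
    \<open>eta p r\<close>.\<close>
  have lhs: "(\<lambda>A. pd b (hlow p h r) m x A - cl_comm n p (C m x) (hlow p h r x) A) = (\<lambda>A. 0)
      \<longleftrightarrow> pd b (h r) m x = cl_comm n p (C m x) (h r x)"
    if "r \<in> {1..n}" for m r x
  proof -
    have F: "cl_has_deriv (\<lambda>t. h r (x + t *\<^sub>R b m)) (pd b (h r) m x)"
      using assms(4) that by (intro smooth_cl_has_deriv) auto
    have "pd b (hlow p h r) m x = cl_scale (eta p r) (pd b (h r) m x)"
    proof
      fix A
      show "pd b (hlow p h r) m x A = cl_scale (eta p r) (pd b (h r) m x) A"
        using cl_has_deriv_scale[OF F, of "eta p r"]
        unfolding pd_def[of b "hlow p h r"] low cl_has_deriv_def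
        by (intro vector_derivative_at) blast
    qed
    moreover have "cl_comm n p (C m x) (hlow p h r x) = cl_scale (eta p r) (cl_comm n p (C m x) (h r x))"
      by (simp only: low cl_comm_eq cl_mult_scale_left cl_mult_scale_right cl.scale_right_diff_distrib)
    moreover have "eta p r \<noteq> 0" by (simp add: eta_def)
    ultimately show ?thesis by (auto simp: fun_eq_iff)
  qed
  have rhs: "(\<lambda>A. \<Sum>k=1..nprime n. mu_coef n k * hproj n p (\<lambda>\<nu>. h \<nu> x) k
        (\<lambda>D. \<Sum>\<rho>=1..n. cl_mult n p (pd b (h \<rho>) m x) (hlow p h \<rho> x) D) A) =
      (\<Sum>k=1..nprime n. cl_scale (mu_coef n k) (hproj n p (\<lambda>\<nu>. h \<nu> x) k
        (\<Sum>r=1..n. cl_mult n p (pd b (h r) m x) (cl_scale (eta p r) (h r x)))))" for m x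
  proof -
    have "(\<lambda>D. \<Sum>\<rho>=1..n. cl_mult n p (pd b (h \<rho>) m x) (hlow p h \<rho> x) D) =
        (\<Sum>r=1..n. cl_mult n p (pd b (h r) m x) (cl_scale (eta p r) (h r x)))"
      by (simp add: fun_eq_iff cl_sum_apply low)
    then show ?thesis by (simp only: cl_scale_def) (simp only: fun_eq_iff cl_sum_apply simp_thms)
  qed
  have key: "(\<forall>r\<in>{1..n}. pd b (h r) m x = cl_comm n p (C m x) (h r x)) \<longleftrightarrow>
      C m x = (\<Sum>k=1..nprime n. cl_scale (mu_coef n k) (hproj n p (\<lambda>\<nu>. h \<nu> x) k
        (\<Sum>r=1..n. cl_mult n p (pd b (h r) m x) (cl_scale (eta p r) (h r x)))))"
    if m: "m \<in> {1..n}" for m x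
  proof -
    \<comment> \<open>The line through \<open>x\<close> in direction \<open>b m\<close> gives a
      curve of frames whose velocity at 0 is the partial derivative.\<close>
    obtain C' where "cl_elem n C'"
      "\<And>r. r \<in> {1..n} \<Longrightarrow> pd b (h r) m x = cl_comm n p C' (h r (x + 0 *\<^sub>R b m))"
    proof (rule deriv_is_commutator)
      show "clifford_frame n p (\<lambda>r. h r (x + t *\<^sub>R b m))" for t
        by (rule clifford_field_vector_frame[OF assms(3)])
      show "cl_has_deriv (\<lambda>t. h r (x + t *\<^sub>R b m)) (pd b (h r) m x)" if "r \<in> {1..n}" for r
        using assms(4) that by (intro smooth_cl_has_deriv) auto
    qed blast
    then show ?thesis
      using assms(5) m
      by (intro clifford_frame.commutator_equation_iff[OF clifford_field_vector_frame[OF assms(3)]])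
        auto
  qed
  have "(\<forall>m\<in>{1..n}. \<forall>r\<in>{1..n}. \<forall>x.
      (\<lambda>A. pd b (hlow p h r) m x A - cl_comm n p (C m x) (hlow p h r x) A) = (\<lambda>A. 0)) \<longleftrightarrow>
      (\<forall>m\<in>{1..n}. \<forall>r\<in>{1..n}. \<forall>x. pd b (h r) m x = cl_comm n p (C m x) (h r x))"
    by (simp only: lhs cong: ball_cong)
  also have "\<dots> \<longleftrightarrow> (\<forall>m\<in>{1..n}. \<forall>x. \<forall>r\<in>{1..n}. pd b (h r) m x = cl_comm n p (C m x) (h r x))"
    by blast
  finally show ?thesis
    unfolding rhs by (simp only: key cong: ball_cong)
qed

end
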